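(* Let $T$ be a theory that is axiomatically appropriate, schematic, and supports weakening. Then there exists a realization $r$ such that for every formula $A$ of the language of modal logic, if $\vdash_{\mathsf{K}} A$ then $T\vdash_{\mathsf{SE}} r(A)$.
   Context: Syntax of $\mathsf{SE}$. There are countably infinite sets of justification constants $\mathsf{JConst}=\{0,1,c_1,c_2,\dots\}$ and justification variables $\mathsf{JVar}=\{x_1,x_2,\dots\}$. Terms: constants, variables, and $s\cdot t$, $s+t$ for terms $s,t$; a ground term is one without variables. Formulas: $\bot$, atomic propositions $P\in\mathsf{Prop}$, $A\to B$, and $t:A$; $\neg,\wedge,\vee,\leftrightarrow$ are abbreviations. $A[w/t]$ is simultaneous replacement of the variable $w$ by term $t$. Axioms of $\mathsf{SE}$ (the axiom schemes, for arbitrary formulas $A,B$ and variables $w,x,y,z$): (CL) propositional tautologies; (j) $x:(A\to B)\to(y:A\to x\cdot y:B)$; (j+) $x:A\wedge y:A\to(x+y):A$; (a+) $A[w/(x+y)+z]\to A[w/x+(y+z)]$; (c+) $A[w/x+y]\to A[w/y+x]$; (0+) $A[w/x+0]\leftrightarrow A[w/x]$; (am) $A[w/(x\cdot y)\cdot z]\leftrightarrow A[w/x\cdot(y\cdot z)]$; (a0) $A[w/x\cdot 0]\leftrightarrow A[w/0]$, $A[w/0\cdot x]\leftrightarrow A[w/0]$; (a1) $A[w/x\cdot 1]\leftrightarrow A[w/x]$, $A[w/1\cdot x]\leftrightarrow A[w/x]$; (dl) $A[w/x\cdot(y+z)]\leftrightarrow A[w/x\cdot y+x\cdot z]$; (dr)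 $A[w/(y+z)\cdot x]\leftrightarrow A[w/y\cdot x+z\cdot x]$. Rules: modus ponens and (jv): from $A$ infer $A[x/t]$. $T\vdash_{\mathsf{SE}}F$: $F$ derivable from axioms and members of the set $T$ by these rules. A theory $T$ is axiomatically appropriate if for every axiom $A$ there is a constant $c$ with $c:A\in T$, and for every $B\in T$ there is a constant $c$ with $c:B\in T$. $T$ is schematic if for each constant $c$, the set $\{A\mid c:A\in T \text{ and } A \text{ is an axiom}\}$ consists of all instances of one or several (possibly zero) axiom schemes of $\mathsf{SE}$. $T$ supports weakening if there is a ground term $t$ such that for all formulas $A,B$: $t:(A\to A\vee B)\in T$ and $t:(B\to A\vee B)\in T$. $\mathsf{K}$ is the basic normal modal logic; $\vdash_{\mathsf{K}}A$ means $A$ is a theorem (valid) in $\mathsf{K}$. For a formula $A$ of $\mathsf{SE}$, $A^\circ$ is the modal formula obtained by replacing every occurrence of $s:$ (for any term $s$) by $\Box$. A realization is a mapping $r$ from modal formulas to formulas of $\mathsf{SE}$ such that $(r(F))^\circ=F$ for every modal formula $F$. *)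

theory Defs
  imports Main
begin

datatype jconst = JZero | JOne | JC nat

datatype jterm =
    Const jconst
  | Var nat
  | App jterm jterm (infixl "\<^bold>\<cdot>" 75)
  | Sum jterm jterm (infixl "\<^bold>+" 70)

abbreviation zero_term :: jterm ("\<^bold>0") where "\<^bold>0 \<equiv> Const JZero"
abbreviation one_term :: jterm ("\<^bold>1") where "\<^bold>1 \<equiv> Const JOne"

primrec ground :: "jterm \<Rightarrow> bool" where
  "ground (Const c) \<longleftrightarrow> True"
| "ground (Var x) \<longleftrightarrow> False"
| "ground (s \<^bold>\<cdot> t) \<longleftrightarrow> ground s \<and> ground t"
| "ground (s \<^bold>+ t) \<longleftrightarrow> ground s \<and> ground t"

datatype 'p fm =
    FBot
  | FAtom 'p
  | FImp "'p fm" "'p fm" (infixr "\<^bold>\<rightarrow>" 55)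
  | FJust jterm "'p fm" (infixr "\<^bold>:" 65)

abbreviation FNot :: "'p fm \<Rightarrow> 'p fm" where
  "FNot A \<equiv> A \<^bold>\<rightarrow> FBot"
abbreviation FOr :: "'p fm \<Rightarrow> 'p fm \<Rightarrow> 'p fm" (infixr "\<^bold>\<or>" 58) where
  "A \<^bold>\<or> B \<equiv> FNot A \<^bold>\<rightarrow> B"
abbreviation FAnd :: "'p fm \<Rightarrow> 'p fm \<Rightarrow> 'p fm" (infixr "\<^bold>\<and>" 60) where
  "A \<^bold>\<and> B \<equiv> FNot (A \<^bold>\<rightarrow> FNot B)"
abbreviation FIff :: "'p fm \<Rightarrow> 'p fm \<Rightarrow> 'p fm" (infixr "\<^bold>\<leftrightarrow>" 53) where
  "A \<^bold>\<leftrightarrow> B \<equiv> (A \<^bold>\<rightarrow> B) \<^bold>\<and> (B \<^bold>\<rightarrow> A)"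

text \<open>\<open>fsubst A w t\<close> is $A[w/t]$; there are no binders, so nothing can be captured.\<close>

primrec tsubst :: "jterm \<Rightarrow> nat \<Rightarrow> jterm \<Rightarrow> jterm" where
  "tsubst (Const c) w t = Const c"
| "tsubst (Var x) w t = (if x = w then t else Var x)"
| "tsubst (r \<^bold>\<cdot> s) w t = tsubst r w t \<^bold>\<cdot> tsubst s w t"
| "tsubst (r \<^bold>+ s) w t = tsubst r w t \<^bold>+ tsubst s w t"

primrec fsubst :: "'p fm \<Rightarrow> nat \<Rightarrow> jterm \<Rightarrow> 'p fm" where
  "fsubst FBot w t = FBot"
| "fsubst (FAtom P) w t = FAtom P"
| "fsubst (A \<^bold>\<rightarrow> B) w t = fsubst A w t \<^bold>\<rightarrow> fsubst B w t"
| "fsubst (s \<^bold>: A) w t = tsubst s w t \<^bold>: fsubst A w t"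

text \<open>
  Propositional schemes over metavariables. \<open>pinst\<close> interprets a scheme in any structure with
  a falsum and an implication: over \<open>bool\<close> it is the truth value under a valuation, over
  the formulas of a language it is the instance under an assignment of formulas to metavariables.
\<close>

datatype pscheme = PBot | PMeta nat | PImp pscheme pscheme

primrec pinst :: "'f \<Rightarrow> ('f \<Rightarrow> 'f \<Rightarrow> 'f) \<Rightarrow> (nat \<Rightarrow> 'f) \<Rightarrow> pscheme \<Rightarrow> 'f" where
  "pinst bt im \<sigma> PBot = bt"
| "pinst bt im \<sigma> (PMeta n) = \<sigma> n"
| "pinst bt im \<sigma> (PImp \<phi> \<psi>) = im (pinst bt im \<sigma> \<phi>) (pinst bt im \<sigma> \<psi>)"

definition ptaut :: "pscheme \<Rightarrow> bool" where
  "ptaut \<phi> \<longleftrightarrow> (\<forall>v. pinst False (\<longrightarrow>) v \<phi>)"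

text \<open>
  Each axiom scheme is represented by the set of its instances. (CL) contributes one scheme for
  every propositional tautology; (a0) and (a1) contribute two schemes each.
\<close>

definition SE_schemes :: "'p fm set set" where
  "SE_schemes =
     {{pinst FBot FImp \<sigma> \<phi> | \<sigma>. True} | \<phi>. ptaut \<phi>} \<union>
     {{Var x \<^bold>: (A \<^bold>\<rightarrow> B) \<^bold>\<rightarrow> (Var y \<^bold>: A \<^bold>\<rightarrow> (Var x \<^bold>\<cdot> Var y) \<^bold>: B) | A B x y. True},
      {(Var x \<^bold>: A \<^bold>\<and> Var y \<^bold>: A) \<^bold>\<rightarrow> (Var x \<^bold>+ Var y) \<^bold>: A | A x y. True},
      {fsubst A w ((Var x \<^bold>+ Var y) \<^bold>+ Var z) \<^bold>\<rightarrow> fsubst A w (Var x \<^bold>+ (Var y \<^bold>+ Var z)) | A w x y z. True},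
      {fsubst A w (Var x \<^bold>+ Var y) \<^bold>\<rightarrow> fsubst A w (Var y \<^bold>+ Var x) | A w x y. True},
      {fsubst A w (Var x \<^bold>+ \<^bold>0) \<^bold>\<leftrightarrow> fsubst A w (Var x) | A w x. True},
      {fsubst A w ((Var x \<^bold>\<cdot> Var y) \<^bold>\<cdot> Var z) \<^bold>\<leftrightarrow> fsubst A w (Var x \<^bold>\<cdot> (Var y \<^bold>\<cdot> Var z)) | A w x y z. True},
      {fsubst A w (Var x \<^bold>\<cdot> \<^bold>0) \<^bold>\<leftrightarrow> fsubst A w \<^bold>0 | A w x. True},
      {fsubst A w (\<^bold>0 \<^bold>\<cdot> Var x) \<^bold>\<leftrightarrow> fsubst A w \<^bold>0 | A w x. True},
      {fsubst A w (Var x \<^bold>\<cdot> \<^bold>1) \<^bold>\<leftrightarrow> fsubst A w (Var x) | A w x. True},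
      {fsubst A w (\<^bold>1 \<^bold>\<cdot> Var x) \<^bold>\<leftrightarrow> fsubst A w (Var x) | A w x. True},
      {fsubst A w (Var x \<^bold>\<cdot> (Var y \<^bold>+ Var z)) \<^bold>\<leftrightarrow> fsubst A w (Var x \<^bold>\<cdot> Var y \<^bold>+ Var x \<^bold>\<cdot> Var z) | A w x y z. True},
      {fsubst A w ((Var y \<^bold>+ Var z) \<^bold>\<cdot> Var x) \<^bold>\<leftrightarrow> fsubst A w (Var y \<^bold>\<cdot> Var x \<^bold>+ Var z \<^bold>\<cdot> Var x) | A w x y z. True}}"

definition SE_axioms :: "'p fm set" where
  "SE_axioms = \<Union> SE_schemes"

inductive SE_derives :: "'p fm set \<Rightarrow> 'p fm \<Rightarrow> bool" for T :: "'p fm set" where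
  SE_ax: "A \<in> SE_axioms \<Longrightarrow> SE_derives T A"
| SE_mem: "A \<in> T \<Longrightarrow> SE_derives T A"
| SE_mp: "SE_derives T (A \<^bold>\<rightarrow> B) \<Longrightarrow> SE_derives T A \<Longrightarrow> SE_derives T B"
| SE_jv: "SE_derives T A \<Longrightarrow> SE_derives T (fsubst A x t)"

definition axiomatically_appropriate :: "'p fm set \<Rightarrow> bool" where
  "axiomatically_appropriate T \<longleftrightarrow>
     (\<forall>A \<in> SE_axioms. \<exists>c. Const c \<^bold>: A \<in> T) \<and>
     (\<forall>B \<in> T. \<exists>c. Const c \<^bold>: B \<in> T)"

definition schematic :: "'p fm set \<Rightarrow> bool" where
  "schematic T \<longleftrightarrow>
     (\<forall>c. \<exists>\<S> \<subseteq> SE_schemes. {A. Const c \<^bold>: A \<in> T \<and> A \<in> SE_axioms} = \<Union> \<S>)"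

definition supports_weakening :: "'p fm set \<Rightarrow> bool" where
  "supports_weakening T \<longleftrightarrow>
     (\<exists>t. ground t \<and> (\<forall>A B. t \<^bold>: (A \<^bold>\<rightarrow> A \<^bold>\<or> B) \<in> T \<and> t \<^bold>: (B \<^bold>\<rightarrow> A \<^bold>\<or> B) \<in> T))"

datatype 'p mfm =
    MBot
  | MAtom 'p
  | MImp "'p mfm" "'p mfm"
  | MBox "'p mfm"

inductive K_derives :: "'p mfm \<Rightarrow> bool" where
  K_taut: "ptaut \<phi> \<Longrightarrow> K_derives (pinst MBot MImp \<sigma> \<phi>)"
| K_ax: "K_derives (MImp (MBox (MImp A B)) (MImp (MBox A) (MBox B)))"
| K_mp: "K_derives (MImp A B) \<Longrightarrow> K_derives A \<Longrightarrow> K_derives B"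
| K_nec: "K_derives A \<Longrightarrow> K_derives (MBox A)"

primrec forget :: "'p fm \<Rightarrow> 'p mfm" where
  "forget FBot = MBot"
| "forget (FAtom P) = MAtom P"
| "forget (A \<^bold>\<rightarrow> B) = MImp (forget A) (forget B)"
| "forget (s \<^bold>: A) = MBox (forget A)"

definition realization :: "('p mfm \<Rightarrow> 'p fm) \<Rightarrow> bool" where
  "realization r \<longleftrightarrow> (\<forall>F. forget (r F) = F)"

end

theory Submission
  imports Defs
begin

text \<open>
  Realize \<open>\<box>A\<close> by a term \<open>s\<close> with \<open>T \<turnstile> s : r(A)\<close> whenever such a term exists, and by \<open>0\<close>
  otherwise. Necessitation holds because \<open>T\<close> internalizes its own derivations. For the
  distribution axiom, realized as \<open>u : (A \<rightarrow> B) \<rightarrow> (v : A \<rightarrow> w : B)\<close>, either \<open>u\<close> and \<open>v\<close> are both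
  provable justifications, so that \<open>B\<close> and hence \<open>w : B\<close> is provable, or one of them is \<open>0\<close>. In the
  latter case \<open>u \<cdot> v\<close> can be replaced by \<open>0\<close>, as \<open>0\<close> is absorbing.
\<close>

text \<open>Only finitely many variables occur in a term. Stating freshness as a threshold lets
  bounds be merged by \<open>max\<close> and supplies several distinct fresh variables at
  once.\<close>

lemma tsubst_fresh: "\<exists>n. \<forall>w\<ge>n. \<forall>t. tsubst s w t = s"
proof (induction s)
  case (Var x)
  show ?case by (rule exI[of _ "Suc x"]) auto
next
  case (App s1 s2)
  then obtain m n where "\<forall>w\<ge>m. \<forall>t. tsubst s1 w t = s1" "\<forall>w\<ge>n. \<forall>t. tsubst s2 w t = s2"
    by blast
  then show ?case by (intro exI[of _ "max m n"]) auto
next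
  case (Sum s1 s2)
  then obtain m n where "\<forall>w\<ge>m. \<forall>t. tsubst s1 w t = s1" "\<forall>w\<ge>n. \<forall>t. tsubst s2 w t = s2"
    by blast
  then show ?case by (intro exI[of _ "max m n"]) auto
qed simp

lemma fsubst_fresh: "\<exists>n. \<forall>w\<ge>n. \<forall>t. fsubst A w t = A"
proof (induction A)
  case (FImp A B)
  then obtain m n where "\<forall>w\<ge>m. \<forall>t. fsubst A w t = A" "\<forall>w\<ge>n. \<forall>t. fsubst B w t = B"
    by blast
  then show ?case by (intro exI[of _ "max m n"]) auto
next
  case (FJust s A)
  obtain m where "\<forall>w\<ge>m. \<forall>t. tsubst s w t = s"
    using tsubst_fresh by blast
  moreover from FJust obtain n where "\<forall>w\<ge>n. \<forall>t. fsubst A w t = A"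
    by blast
  ultimately show ?case by (intro exI[of _ "max m n"]) auto
qed simp_all

lemma SE_axiomsI: "S \<in> SE_schemes \<Longrightarrow> A \<in> S \<Longrightarrow> A \<in> SE_axioms"
  unfolding SE_axioms_def by (rule UnionI)

lemma SE_derives_taut:
  assumes "ptaut \<phi>"
  shows "SE_derives T (pinst FBot FImp \<sigma> \<phi>)"
proof (rule SE_ax, rule SE_axiomsI)
  show "{pinst FBot FImp \<sigma> \<phi> | \<sigma>. True} \<in> SE_schemes"
    unfolding SE_schemes_def using assms by (intro UnI1) blast
qed blast

lemma SE_derives_weaken:
  assumes "SE_derives T B"
  shows "SE_derives T (A \<^bold>\<rightarrow> B)"
proof -
  have "ptaut (PImp (PMeta 1) (PImp (PMeta 0) (PMeta 1)))"
    by (simp add: ptaut_def)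
  from SE_derives_taut[OF this, of T "(\<lambda>_. B)(0 := A)"]
  have "SE_derives T (B \<^bold>\<rightarrow> A \<^bold>\<rightarrow> B)" by simp
  then show ?thesis using assms by (rule SE_mp)
qed

lemma SE_derives_imp_trans2:
  assumes "SE_derives T (A \<^bold>\<rightarrow> B \<^bold>\<rightarrow> C)" and "SE_derives T (C \<^bold>\<rightarrow> D)"
  shows "SE_derives T (A \<^bold>\<rightarrow> B \<^bold>\<rightarrow> D)"
proof -
  have "ptaut (PImp (PImp (PMeta 0) (PImp (PMeta 1) (PMeta 2)))
      (PImp (PImp (PMeta 2) (PMeta 3)) (PImp (PMeta 0) (PImp (PMeta 1) (PMeta 3)))))"
    by (simp add: ptaut_def)
  from SE_derives_taut[OF this, of T "(\<lambda>_. D)(0 := A, 1 := B, 2 := C)"]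
  have "SE_derives T ((A \<^bold>\<rightarrow> B \<^bold>\<rightarrow> C) \<^bold>\<rightarrow> (C \<^bold>\<rightarrow> D) \<^bold>\<rightarrow> A \<^bold>\<rightarrow> B \<^bold>\<rightarrow> D)" by simp
  from SE_mp[OF SE_mp[OF this assms(1)] assms(2)] show ?thesis .
qed

lemma SE_derives_iffD1:
  assumes "SE_derives T (A \<^bold>\<leftrightarrow> B)"
  shows "SE_derives T (A \<^bold>\<rightarrow> B)"
proof -
  \<comment> \<open>Conjunction is encoded by implication and falsum, so the scheme below is the
    unfolded form of \<open>p\<close> and \<open>q\<close> implies \<open>p\<close>.\<close>
  define p where "p = PImp (PMeta 0) (PMeta 1)"
  define q where "q = PImp (PMeta 1) (PMeta 0)"
  have "ptaut (PImp (PImp (PImp p (PImp q PBot)) PBot) p)"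
    by (simp add: ptaut_def p_def q_def)
  from SE_derives_taut[OF this, of T "(\<lambda>_. B)(0 := A)"]
  have "SE_derives T ((A \<^bold>\<leftrightarrow> B) \<^bold>\<rightarrow> A \<^bold>\<rightarrow> B)" by (simp add: p_def q_def)
  then show ?thesis using assms by (rule SE_mp)
qed

text \<open>The axioms mention variables only, so their term instances are obtained by (jv) at
  variables fresh for the formulas involved.\<close>

lemma SE_derives_app:
  fixes T :: "'p fm set"
  shows "SE_derives T (s \<^bold>: (A \<^bold>\<rightarrow> B) \<^bold>\<rightarrow> t \<^bold>: A \<^bold>\<rightarrow> (s \<^bold>\<cdot> t) \<^bold>: B)"
proof -
  obtain k where k: "\<forall>w\<ge>k. \<forall>t. tsubst s w t = s"
    using tsubst_fresh by blast
  obtain m where m: "\<forall>w\<ge>m. \<forall>t. fsubst (A \<^bold>\<rightarrow> B) w t = (A \<^bold>\<rightarrow> B)"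
    using fsubst_fresh by blast
  define x where "x = max k m"
  \<comment> \<open>The term \<open>s\<close> is put in for \<open>x\<close> first and is then
    exposed to the substitution at \<open>Suc x\<close>; \<open>t\<close> comes last, so it may
    contain any variables.\<close>
  have fresh: "tsubst s (Suc x) u = s" "fsubst A x u = A" "fsubst A (Suc x) u = A"
    "fsubst B x u = B" "fsubst B (Suc x) u = B" for u
    using k m by (auto simp: x_def)
  have "({Var x \<^bold>: (A \<^bold>\<rightarrow> B) \<^bold>\<rightarrow> (Var y \<^bold>: A \<^bold>\<rightarrow> (Var x \<^bold>\<cdot> Var y) \<^bold>: B) | A B x y. True} :: 'p fm set) \<in> SE_schemes"
    unfolding SE_schemes_def by (rule UnI2) (rule insertI1 | rule insertI2)+
  then have "Var x \<^bold>: (A \<^bold>\<rightarrow> B) \<^bold>\<rightarrow> Var (Suc x) \<^bold>: A \<^bold>\<rightarrow> (Var x \<^bold>\<cdot> Var (Suc x)) \<^bold>: B \<in> SE_axioms"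
    by (rule SE_axiomsI) blast
  from SE_jv[OF SE_jv[OF SE_ax[OF this], of _ x s], of _ "Suc x" t]
  show ?thesis by (simp add: fresh)
qed

lemma SE_derives_zero_left:
  fixes T :: "'p fm set"
  shows "SE_derives T ((\<^bold>0 \<^bold>\<cdot> t) \<^bold>: A \<^bold>\<rightarrow> \<^bold>0 \<^bold>: A)"
proof -
  obtain x where x: "\<forall>w\<ge>x. \<forall>t. fsubst A w t = A"
    using fsubst_fresh by blast
  have "({fsubst A w (\<^bold>0 \<^bold>\<cdot> Var x) \<^bold>\<leftrightarrow> fsubst A w \<^bold>0 | A w x. True} :: 'p fm set) \<in> SE_schemes"
    unfolding SE_schemes_def by (rule UnI2) (rule insertI1 | rule insertI2)+
  \<comment> \<open>The replaced variable is the outermost justification of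
    \<open>Var x : A\<close>. As \<open>x\<close> is fresh for \<open>A\<close>, the equation acts
    on that term alone.\<close>
  then have "fsubst (Var x \<^bold>: A) x (\<^bold>0 \<^bold>\<cdot> Var x) \<^bold>\<leftrightarrow> fsubst (Var x \<^bold>: A) x \<^bold>0 \<in> SE_axioms"
    by (rule SE_axiomsI) blast
  from SE_jv[OF SE_derives_iffD1[OF SE_ax[OF this]], of _ x t]
  show ?thesis by (simp add: x)
qed

lemma SE_derives_zero_right:
  fixes T :: "'p fm set"
  shows "SE_derives T ((t \<^bold>\<cdot> \<^bold>0) \<^bold>: A \<^bold>\<rightarrow> \<^bold>0 \<^bold>: A)"
proof -
  obtain x where x: "\<forall>w\<ge>x. \<forall>t. fsubst A w t = A"
    using fsubst_fresh by blast
  have "({fsubst A w (Var x \<^bold>\<cdot> \<^bold>0) \<^bold>\<leftrightarrow> fsubst A w \<^bold>0 | A w x. True} :: 'p fm set) \<in> SE_schemes"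
    unfolding SE_schemes_def by (rule UnI2) (rule insertI1 | rule insertI2)+
  then have "fsubst (Var x \<^bold>: A) x (Var x \<^bold>\<cdot> \<^bold>0) \<^bold>\<leftrightarrow> fsubst (Var x \<^bold>: A) x \<^bold>0 \<in> SE_axioms"
    by (rule SE_axiomsI) blast
  from SE_jv[OF SE_derives_iffD1[OF SE_ax[OF this]], of _ x t]
  show ?thesis by (simp add: x)
qed

text \<open>Induction on the derivation: constants justify axioms and members of \<open>T\<close>,
  and modus ponens becomes application.\<close>

lemma SE_internalization:
  assumes "axiomatically_appropriate T" and "SE_derives T A"
  shows "\<exists>s. SE_derives T (s \<^bold>: A)"
  using assms(2)
proof induction
  case (SE_ax A)
  then show ?case
    using assms(1) unfolding axiomatically_appropriate_def by (blast intro: SE_mem)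
next
  case (SE_mem A)
  then show ?case
    using assms(1) unfolding axiomatically_appropriate_def by (blast intro: SE_derives.SE_mem)
next
  case (SE_mp A B)
  then obtain s t where "SE_derives T (s \<^bold>: (A \<^bold>\<rightarrow> B))" "SE_derives T (t \<^bold>: A)" by blast
  from SE_derives.SE_mp[OF SE_derives.SE_mp[OF SE_derives_app this(1)] this(2)]
  show ?case by blast
next
  case (SE_jv A x t)
  then obtain s where "SE_derives T (s \<^bold>: A)" by blast
  \<comment> \<open>The substitution also acts on the justification, so the new witness is
    \<open>tsubst s x t\<close>.\<close>
  from SE_derives.SE_jv[OF this, of x t] show ?case by auto
qed

definition justifier :: "'p fm set \<Rightarrow> 'p fm \<Rightarrow> jterm" where
  "justifier T A =
     (if \<exists>s. SE_derives T (s \<^bold>: A) then SOME s. SE_derives T (s \<^bold>: A) else \<^bold>0)"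

lemma SE_derives_justifier:
  assumes "axiomatically_appropriate T" and "SE_derives T A"
  shows "SE_derives T (justifier T A \<^bold>: A)"
  using SE_internalization[OF assms] by (auto simp: justifier_def intro: someI_ex)

lemma justifier_cases: "SE_derives T (justifier T A \<^bold>: A) \<or> justifier T A = \<^bold>0"
  by (auto simp: justifier_def intro: someI_ex)

text \<open>The split is on whether \<open>B\<close> has any derivable justification. If it has, the
  final consequent is derivable outright; if not, \<open>w\<close> takes the default
  \<open>0\<close>.\<close>

lemma SE_derives_justifier_K:
  "SE_derives T (justifier T (A \<^bold>\<rightarrow> B) \<^bold>: (A \<^bold>\<rightarrow> B) \<^bold>\<rightarrow> justifier T A \<^bold>: A \<^bold>\<rightarrow> justifier T B \<^bold>: B)"
    (is "SE_derives T (?u \<^bold>: _ \<^bold>\<rightarrow> ?v \<^bold>: _ \<^bold>\<rightarrow> ?w \<^bold>: _)")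
proof (cases "\<exists>s. SE_derives T (s \<^bold>: B)")
  case True
  then have "SE_derives T (?w \<^bold>: B)"
    by (auto simp: justifier_def intro: someI_ex)
  then show ?thesis by (intro SE_derives_weaken)
next
  case False
  then have w: "?w = \<^bold>0" by (simp add: justifier_def)
  \<comment> \<open>Otherwise two uses of modus ponens would make the product of \<open>u\<close>
    and \<open>v\<close> a derivable justification of \<open>B\<close>.\<close>
  have "\<not> (SE_derives T (?u \<^bold>: (A \<^bold>\<rightarrow> B)) \<and> SE_derives T (?v \<^bold>: A))"
    using False SE_mp[OF SE_mp[OF SE_derives_app]] by blast
  then have "?u = \<^bold>0 \<or> ?v = \<^bold>0" using justifier_cases by blast
  then have "SE_derives T ((?u \<^bold>\<cdot> ?v) \<^bold>: B \<^bold>\<rightarrow> \<^bold>0 \<^bold>: B)"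
    using SE_derives_zero_left SE_derives_zero_right by metis
  then show ?thesis
    unfolding w by (rule SE_derives_imp_trans2[OF SE_derives_app])
qed

primrec realize :: "'p fm set \<Rightarrow> 'p mfm \<Rightarrow> 'p fm" where
  "realize T MBot = FBot"
| "realize T (MAtom P) = FAtom P"
| "realize T (MImp A B) = realize T A \<^bold>\<rightarrow> realize T B"
| "realize T (MBox A) = justifier T (realize T A) \<^bold>: realize T A"

lemma realization_realize: "realization (realize T)"
proof -
  have "forget (realize T F) = F" for F by (induction F) simp_all
  then show ?thesis by (simp add: realization_def)
qed

text \<open>The realization of a box depends only on the boxed formula, not on its position. All
  occurrences of a metavariable thus receive the same formula, and tautology instances are
  preserved.\<close>

lemma realize_pinst:
  "realize T (pinst MBot MImp \<sigma> \<phi>) = pinst FBot FImp (\<lambda>n. realize T (\<sigma> n)) \<phi>"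
  by (induction \<phi>) simp_all

lemma SE_derives_realize:
  assumes "axiomatically_appropriate T" and "K_derives A"
  shows "SE_derives T (realize T A)"
  using assms(2)
proof induction
  case (K_taut \<phi> \<sigma>)
  then show ?case by (simp add: realize_pinst SE_derives_taut)
next
  case (K_ax A B)
  show ?case by (simp add: SE_derives_justifier_K)
next
  case (K_mp A B)
  then show ?case by (auto intro: SE_mp)
next
  case (K_nec A)
  then show ?case by (simp add: SE_derives_justifier[OF assms(1)])
qed

theorem mainTheorem3:
  fixes T :: "'p fm set"
  assumes "axiomatically_appropriate T"
    and "schematic T"
    and "supports_weakening T"
  shows "\<exists>r :: 'p mfm \<Rightarrow> 'p fm. realization r \<and> (\<forall>A. K_derives A \<longrightarrow> SE_derives T (r A))"
  using realization_realize SE_derives_realize[OF assms(1)] by blast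

end
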